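(* For any integer $b\ge 1$, there exists a strictly $(1+\frac{1}{2^{b-1}})$-competitive online algorithm with advice for multi-coloring bipartite graphs with advice complexity $b+[\![a]\!]$, where $a+b$ is the total number of bits in the binary representation of $\mathrm{Opt}$.
   Context: Online multi-coloring: the graph is known in advance; requests arrive one at a time, each naming a node $v$, and must immediately and irrevocably receive a color (positive integer) different from every color previously assigned to $v$ or any neighbor of $v$. $A(I)$ is the number of colors used by algorithm $A$ on request sequence $I$ and $\mathrm{Opt}=\mathrm{Opt}(I)$ is the minimum number of colors an offline algorithm needs on $I$. Advice model: an all-powerful oracle knowing $I$ writes an infinite binary advice tape; advice complexity is the maximum index of a bit read. Strictly $c$-competitive means $A(I)\le c\cdot\mathrm{Opt}(I)$ for all $I$. $[\![x]\!]$ denotes the minimum number of bits needed to encode the non-negative integer $x$ in a self-delimiting way. *)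

theory Defs
  imports
    Complex_Main
    "HOL-Library.Log_Nat"
    "HOL-Library.Sublist"
    "Graph_Theory.Pair_Digraph"
begin

section \<open>Multi-coloring\<close>

text \<open>
  Finite simple undirected graphs are the symmetric loop-free digraphs \<open>pair_graph\<close>:
  \<open>u\<close> and \<open>v\<close> are neighbors iff \<open>(u, v) \<in> parcs G\<close>.
\<close>

definition bipartite :: "'v pair_pre_digraph \<Rightarrow> bool" where
  "bipartite G \<longleftrightarrow>
    (\<exists>X Y. pverts G = X \<union> Y \<and> X \<inter> Y = {} \<and> parcs G \<subseteq> X \<times> Y \<union> Y \<times> X)"

definition bipartite_graphs :: "'v pair_pre_digraph set" where
  "bipartite_graphs = {G. pair_graph G \<and> bipartite G}"

text \<open>The entry \<open>cs ! i\<close> is the color given to the request \<open>I ! i\<close>.\<close>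

definition multicoloring :: "'v pair_pre_digraph \<Rightarrow> 'v list \<Rightarrow> nat list \<Rightarrow> bool" where
  "multicoloring G I cs \<longleftrightarrow>
    length cs = length I \<and> (\<forall>c \<in> set cs. c > 0) \<and>
    (\<forall>j < length I. \<forall>i < j.
      I ! i = I ! j \<or> (I ! i, I ! j) \<in> parcs G \<longrightarrow> cs ! i \<noteq> cs ! j)"

definition Opt :: "'v pair_pre_digraph \<Rightarrow> 'v list \<Rightarrow> nat" where
  "Opt G I = (LEAST k. \<exists>cs. multicoloring G I cs \<and> card (set cs) = k)"

section \<open>Online algorithms with advice\<close>

text \<open>\<open>tape i\<close> is the bit with (one-based) index \<open>Suc i\<close>.\<close>

type_synonym tape = "nat \<Rightarrow> bool"

datatype action = Read nat | Color nat

text \<open>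
  To serve a request, an algorithm repeatedly chooses an action: it reads a tape cell, or it
  commits to a color. The choice may depend on the graph, on the requests seen so far (the
  current one being the last), and on the cells read while serving the current request. Bits
  read and colors chosen for earlier requests can be recomputed from this data; rereading a cell
  does not affect the advice complexity, which only depends on the set of cells read.
\<close>

type_synonym 'v algorithm =
  "'v pair_pre_digraph \<Rightarrow> 'v list \<Rightarrow> (nat \<times> bool) list \<Rightarrow> action"

type_synonym 'v advisor = "'v pair_pre_digraph \<Rightarrow> 'v list \<Rightarrow> tape"

text \<open>
  \<open>serve A G \<phi> rs tr c R\<close>: having read \<open>tr\<close> so far, \<open>A\<close> reads exactly the further cells \<open>R\<close>
  and then answers the last request of \<open>rs\<close> with color \<open>c\<close>. There is no such \<open>c\<close> if \<open>A\<close>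
  keeps reading forever.
\<close>

inductive serve ::
  "'v algorithm \<Rightarrow> 'v pair_pre_digraph \<Rightarrow> tape \<Rightarrow> 'v list \<Rightarrow> (nat \<times> bool) list \<Rightarrow> nat \<Rightarrow> nat set \<Rightarrow> bool"
  for A G \<phi> rs where
  color: "A G rs tr = Color c \<Longrightarrow> serve A G \<phi> rs tr c {}"
| read: "A G rs tr = Read i \<Longrightarrow> serve A G \<phi> rs (tr @ [(i, \<phi> i)]) c R \<Longrightarrow>
    serve A G \<phi> rs tr c (insert i R)"

definition run ::
  "'v algorithm \<Rightarrow> 'v pair_pre_digraph \<Rightarrow> tape \<Rightarrow> 'v list \<Rightarrow> nat list \<Rightarrow> nat set \<Rightarrow> bool" where
  "run A G \<phi> I cs R \<longleftrightarrow>
    length cs = length I \<and>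
    (\<exists>Q. (\<forall>j < length I. serve A G \<phi> (take (Suc j) I) [] (cs ! j) (Q j)) \<and>
         R = (\<Union>j < length I. Q j))"

lemma serve_deterministic:
  "serve A G \<phi> rs tr c R \<Longrightarrow> serve A G \<phi> rs tr c' R' \<Longrightarrow> c = c' \<and> R = R'"
proof (induction arbitrary: R' rule: serve.induct)
  case (color tr c)
  then show ?case by (auto elim: serve.cases)
next
  case (read tr i c R)
  from read.prems show ?case
    by (cases rule: serve.cases) (use read in auto)
qed

lemma run_deterministic:
  assumes "run A G \<phi> I cs R" "run A G \<phi> I cs' R'"
  shows "cs = cs' \<and> R = R'"
proof -
  from assms obtain Q Q' where
    Q: "\<forall>j < length I. serve A G \<phi> (take (Suc j) I) [] (cs ! j) (Q j)"
      "R = (\<Union>j < length I. Q j)" "length cs = length I" and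
    Q': "\<forall>j < length I. serve A G \<phi> (take (Suc j) I) [] (cs' ! j) (Q' j)"
      "R' = (\<Union>j < length I. Q' j)" "length cs' = length I"
    unfolding run_def by blast
  have "cs ! j = cs' ! j \<and> Q j = Q' j" if "j < length I" for j
    using Q(1) Q'(1) that serve_deterministic by blast
  then show ?thesis
    using Q Q' by (auto intro: nth_equalityI)
qed

definition max_index :: "nat set \<Rightarrow> nat" where
  "max_index R = Max (insert 0 (Suc ` R))"

definition online_algorithm ::
  "'v pair_pre_digraph set \<Rightarrow> 'v algorithm \<Rightarrow> 'v advisor \<Rightarrow> bool" where
  "online_algorithm \<G> A \<O> \<longleftrightarrow>
    (\<forall>G \<in> \<G>. \<forall>I \<in> lists (pverts G).
      \<exists>cs R. run A G (\<O> G I) I cs R \<and> multicoloring G I cs)"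

definition strictly_competitive ::
  "'v pair_pre_digraph set \<Rightarrow> real \<Rightarrow> 'v algorithm \<Rightarrow> 'v advisor \<Rightarrow> bool" where
  "strictly_competitive \<G> r A \<O> \<longleftrightarrow>
    (\<forall>G \<in> \<G>. \<forall>I \<in> lists (pverts G). \<forall>cs R.
      run A G (\<O> G I) I cs R \<longrightarrow> real (card (set cs)) \<le> r * real (Opt G I))"

text \<open>The bound on the advice complexity is a function of the value of \<open>Opt\<close>.\<close>

definition advice_complexity_le ::
  "'v pair_pre_digraph set \<Rightarrow> (nat \<Rightarrow> nat) \<Rightarrow> 'v algorithm \<Rightarrow> 'v advisor \<Rightarrow> bool" where
  "advice_complexity_le \<G> f A \<O> \<longleftrightarrow>
    (\<forall>G \<in> \<G>. \<forall>I \<in> lists (pverts G). \<forall>cs R.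
      run A G (\<O> G I) I cs R \<longrightarrow> max_index R \<le> f (Opt G I))"

section \<open>Self-delimiting encodings\<close>

text \<open>
  A self-delimiting encoding of the natural numbers is given by its decoder: \<open>D w = Some x\<close> means
  that \<open>w\<close> is a codeword for \<open>x\<close>. A number may have several codewords. No codeword is a proper
  prefix of another, so the end of a codeword on the tape is recognized without reading on.
\<close>

definition self_delimiting :: "(bool list \<Rightarrow> nat option) \<Rightarrow> bool" where
  "self_delimiting D \<longleftrightarrow>
    (\<forall>x. \<exists>w. D w = Some x) \<and>
    (\<forall>u \<in> dom D. \<forall>w \<in> dom D. prefix u w \<longrightarrow> u = w)"

definition enc_bits :: "(bool list \<Rightarrow> nat option) \<Rightarrow> nat \<Rightarrow> nat" where
  "enc_bits D x = (LEAST n. \<exists>w. D w = Some x \<and> length w = n)"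

end

theory Submission
  imports Defs
begin

text \<open>
  If \<open>k \<ge> Opt\<close> is known, give the \<open>n\<close>-th request of a node the color \<open>n\<close> on one side of the
  bipartition and \<open>k + 1 - n\<close> on the other. Two neighbors together receive at most \<open>Opt \<le> k\<close>
  requests, so their color ranges \<open>{1..n}\<close> and \<open>{k + 1 - m..k}\<close> do not meet, and at most \<open>k\<close>
  colors are used. The advice is a codeword for \<open>a\<close> followed by the \<open>b\<close> leading bits of \<open>Opt\<close>.
  Filling the \<open>a\<close> unknown bits with ones yields \<open>k\<close>, which exceeds \<open>Opt\<close> by at most
  \<open>2\<^sup>a - 1\<close>. This is \<open>0\<close> if \<open>a = 0\<close> and less than \<open>2\<^sup>a \<le> Opt / 2\<^sup>b\<^sup>-\<^sup>1\<close> otherwise.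
\<close>

section \<open>Cliques bound the number of colors\<close>

lemma sum_count_list_eq_card:
  assumes "finite K"
  shows "(\<Sum>v\<in>K. count_list I v) = card {i. i < length I \<and> I ! i \<in> K}"
proof -
  have "count_list (filter (\<lambda>v. v \<in> K) I) v = count_list I v" if "v \<in> K" for v
    using that by (induction I) auto
  then have "(\<Sum>v\<in>K. count_list I v) = length (filter (\<lambda>v. v \<in> K) I)"
    using sum_count_set[of "filter (\<lambda>v. v \<in> K) I" K] assms by auto
  then show ?thesis
    by (simp add: length_filter_conv_card)
qed

lemma sum_count_list_clique_le_card:
  assumes "multicoloring G I cs" and "finite K"
    and clique: "\<And>u v. u \<in> K \<Longrightarrow> v \<in> K \<Longrightarrow> u = v \<or> (u, v) \<in> parcs G"
  shows "(\<Sum>v\<in>K. count_list I v) \<le> card (set cs)"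
proof -
  let ?S = "{i. i < length I \<and> I ! i \<in> K}"
  have len: "length cs = length I"
    and proper: "\<And>i j. j < length I \<Longrightarrow> i < j \<Longrightarrow> I ! i = I ! j \<or> (I ! i, I ! j) \<in> parcs G \<Longrightarrow>
      cs ! i \<noteq> cs ! j"
    using assms(1) unfolding multicoloring_def by auto
  have "inj_on ((!) cs) ?S"
    using clique proper by (intro linorder_inj_onI) auto
  moreover have "(!) cs ` ?S \<subseteq> set cs"
    using len by auto
  ultimately have "card ?S \<le> card (set cs)"
    by (rule card_inj_on_le) simp
  then show ?thesis
    by (simp add: sum_count_list_eq_card[OF \<open>finite K\<close>])
qed

lemma Opt_attained:
  obtains cs where "multicoloring G I cs" and "card (set cs) = Opt G I"
proof -
  have "multicoloring G I [1..<Suc (length I)]"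
    unfolding multicoloring_def by (auto simp del: upt_Suc)
  then have "\<exists>k cs. multicoloring G I cs \<and> card (set cs) = k"
    by blast
  from LeastI_ex[OF this] show thesis
    using that unfolding Opt_def by blast
qed

lemma sum_count_list_clique_le_Opt:
  assumes "finite K" and "\<And>u v. u \<in> K \<Longrightarrow> v \<in> K \<Longrightarrow> u = v \<or> (u, v) \<in> parcs G"
  shows "(\<Sum>v\<in>K. count_list I v) \<le> Opt G I"
  by (metis Opt_attained sum_count_list_clique_le_card assms)

lemma count_list_le_Opt: "count_list I v \<le> Opt G I"
  using sum_count_list_clique_le_Opt[of "{v}" G I] by simp

lemma count_list_add_le_Opt:
  assumes "pair_graph G" and "(u, v) \<in> parcs G"
  shows "count_list I u + count_list I v \<le> Opt G I"
proof -
  interpret pair_graph G by fact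
  have "(v, u) \<in> parcs G" "u \<noteq> v"
    using arcs_symmetric[OF assms(2)] no_loops[OF assms(2)] by auto
  then show ?thesis
    using sum_count_list_clique_le_Opt[of "{u, v}" G I] assms(2) by auto
qed

section \<open>Coloring the two sides from opposite ends\<close>

definition online_coloring :: "('v list \<Rightarrow> nat) \<Rightarrow> 'v list \<Rightarrow> nat list" where
  "online_coloring f I = map (\<lambda>j. f (take (Suc j) I)) [0..<length I]"

definition two_sided_color :: "'v set \<Rightarrow> nat \<Rightarrow> 'v list \<Rightarrow> nat" where
  "two_sided_color X k rs =
    (let n = count_list rs (last rs) in if last rs \<in> X then n else k + 1 - n)"

definition occurrence_number :: "'a list \<Rightarrow> nat \<Rightarrow> nat" where
  "occurrence_number xs j = count_list (take (Suc j) xs) (xs ! j)"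

lemma count_list_take_mono:
  assumes "m \<le> n"
  shows "count_list (take m xs) x \<le> count_list (take n xs) x"
proof -
  have "take n xs = take m xs @ take (n - m) (drop m xs)"
    using assms by (metis le_add_diff_inverse take_add)
  then show ?thesis
    by simp
qed

lemma occurrence_number_pos: "j < length xs \<Longrightarrow> 0 < occurrence_number xs j"
  by (simp add: occurrence_number_def take_Suc_conv_app_nth)

lemma occurrence_number_le_count_list:
  "j < length xs \<Longrightarrow> occurrence_number xs j \<le> count_list xs (xs ! j)"
  using count_list_take_mono[of "Suc j" "length xs" xs] by (simp add: occurrence_number_def)

lemma occurrence_number_strict_mono:
  assumes "i < j" and "j < length xs" and "xs ! i = xs ! j"
  shows "occurrence_number xs i < occurrence_number xs j"
  using assms count_list_take_mono[of "Suc i" j xs "xs ! j"]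
  by (simp add: occurrence_number_def take_Suc_conv_app_nth[of j])

lemma two_sided_coloring_nth:
  assumes "j < length I"
  shows "online_coloring (two_sided_color X k) I ! j =
    (if I ! j \<in> X then occurrence_number I j else k + 1 - occurrence_number I j)"
  using assms
  by (simp add: online_coloring_def two_sided_color_def occurrence_number_def take_Suc_conv_app_nth)

lemma set_two_sided_coloring_subset:
  assumes "\<And>v. count_list I v \<le> k"
  shows "set (online_coloring (two_sided_color X k) I) \<subseteq> {1..k}"
proof
  fix c
  assume "c \<in> set (online_coloring (two_sided_color X k) I)"
  then obtain j where j: "j < length I" "c = online_coloring (two_sided_color X k) I ! j"
    by (auto simp: in_set_conv_nth online_coloring_def)
  have "occurrence_number I j \<le> k"
    using occurrence_number_le_count_list[OF j(1)] assms order_trans by blast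
  then show "c \<in> {1..k}"
    using j occurrence_number_pos[OF j(1)] by (auto simp: two_sided_coloring_nth)
qed

lemma card_two_sided_coloring_le:
  assumes "\<And>v. count_list I v \<le> k"
  shows "card (set (online_coloring (two_sided_color X k) I)) \<le> k"
  using card_mono[OF _ set_two_sided_coloring_subset[OF assms]] by simp

lemma multicoloring_two_sided:
  assumes sides: "\<And>u v. (u, v) \<in> parcs G \<Longrightarrow> u \<in> X \<longleftrightarrow> v \<notin> X"
    and node_le: "\<And>v. count_list I v \<le> k"
    and arc_le: "\<And>u v. (u, v) \<in> parcs G \<Longrightarrow> count_list I u + count_list I v \<le> k"
  shows "multicoloring G I (online_coloring (two_sided_color X k) I)"
proof -
  let ?cs = "online_coloring (two_sided_color X k) I"
  have "?cs ! i \<noteq> ?cs ! j"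
    if ij: "i < j" "j < length I" and conflict: "I ! i = I ! j \<or> (I ! i, I ! j) \<in> parcs G" for i j
  proof -
    have occ_le: "occurrence_number I i \<le> count_list I (I ! i)"
      "occurrence_number I j \<le> count_list I (I ! j)"
      using ij by (simp_all add: occurrence_number_le_count_list)
    from conflict show ?thesis
    proof
      assume "I ! i = I ! j"
      then show ?thesis
        using ij occurrence_number_strict_mono[OF ij] occ_le node_le[of "I ! j"]
        by (auto simp: two_sided_coloring_nth)
    next
      assume "(I ! i, I ! j) \<in> parcs G"
      then show ?thesis
        using ij occ_le sides arc_le by (fastforce simp: two_sided_coloring_nth)
    qed
  qed
  then show ?thesis
    using set_two_sided_coloring_subset[OF node_le, of X]
    unfolding multicoloring_def by (auto simp: online_coloring_def)
qed

definition left_side :: "'v pair_pre_digraph \<Rightarrow> 'v set" where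
  "left_side G = (SOME X. \<forall>u v. (u, v) \<in> parcs G \<longrightarrow> (u \<in> X \<longleftrightarrow> v \<notin> X))"

lemma left_side_arc:
  assumes "bipartite G" and "(u, v) \<in> parcs G"
  shows "u \<in> left_side G \<longleftrightarrow> v \<notin> left_side G"
proof -
  obtain X Y where "X \<inter> Y = {}" "parcs G \<subseteq> X \<times> Y \<union> Y \<times> X"
    using assms(1) unfolding bipartite_def by blast
  then have "\<forall>u v. (u, v) \<in> parcs G \<longrightarrow> (u \<in> X \<longleftrightarrow> v \<notin> X)"
    by auto
  then have "\<forall>u v. (u, v) \<in> parcs G \<longrightarrow> (u \<in> left_side G \<longleftrightarrow> v \<notin> left_side G)"
    unfolding left_side_def by (rule someI)
  then show ?thesis
    using assms(2) by blast
qed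

lemma multicoloring_left_side:
  assumes "G \<in> bipartite_graphs" and "Opt G I \<le> k"
  shows "multicoloring G I (online_coloring (two_sided_color (left_side G) k) I)"
proof (rule multicoloring_two_sided)
  have "pair_graph G" "bipartite G"
    using assms(1) by (auto simp: bipartite_graphs_def)
  show "count_list I v \<le> k" for v
    using count_list_le_Opt assms(2) by (rule order_trans)
  show "count_list I u + count_list I v \<le> k" if "(u, v) \<in> parcs G" for u v
    using count_list_add_le_Opt[OF \<open>pair_graph G\<close> that] assms(2) by (rule order_trans)
  show "u \<in> left_side G \<longleftrightarrow> v \<notin> left_side G" if "(u, v) \<in> parcs G" for u v
    using left_side_arc[OF \<open>bipartite G\<close> that] .
qed

section \<open>Prefix-free decoders\<close>

definition prefix_free :: "('c list \<Rightarrow> 'a option) \<Rightarrow> bool" where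
  "prefix_free D \<longleftrightarrow> (\<forall>u \<in> dom D. \<forall>w \<in> dom D. prefix u w \<longrightarrow> u = w)"

lemma prefix_freeD: "prefix_free D \<Longrightarrow> u \<in> dom D \<Longrightarrow> w \<in> dom D \<Longrightarrow> prefix u w \<Longrightarrow> u = w"
  by (simp add: prefix_free_def)

lemma prefix_free_take_eq_None:
  assumes "prefix_free D" and "D w = Some x" and "m < length w"
  shows "D (take m w) = None"
proof (rule ccontr)
  assume "D (take m w) \<noteq> None"
  then have "take m w = w"
    using prefix_freeD[OF assms(1)] assms(2) take_is_prefix by blast
  then show False
    using assms(3) by simp
qed

definition with_suffix :: "nat \<Rightarrow> ('c list \<Rightarrow> 'a option) \<Rightarrow> 'c list \<Rightarrow> ('a \<times> 'c list) option" where
  "with_suffix b D zs =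
    (if length zs < b then None
     else let m = length zs - b in map_option (\<lambda>x. (x, drop m zs)) (D (take m zs)))"

lemma with_suffix_append: "D w = Some x \<Longrightarrow> with_suffix (length v) D (w @ v) = Some (x, v)"
  by (simp add: with_suffix_def)

lemma prefix_free_with_suffix:
  assumes "prefix_free D"
  shows "prefix_free (with_suffix b D)"
  unfolding prefix_free_def
proof (intro ballI impI)
  fix u w
  assume dom: "u \<in> dom (with_suffix b D)" "w \<in> dom (with_suffix b D)" and "prefix u w"
  let ?u = "take (length u - b) u" and ?w = "take (length w - b) w"
  have le: "b \<le> length u" "b \<le> length w" and D: "?u \<in> dom D" "?w \<in> dom D"
    using dom by (auto simp: with_suffix_def Let_def split: if_splits)
  have "prefix ?u w" "prefix ?w w"
    using \<open>prefix u w\<close> take_is_prefix prefix_order.trans by blast+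
  then have "?u = ?w"
    using prefix_freeD[OF assms] D by (metis prefix_same_cases)
  then have "length u - b = length w - b"
    by (metis length_take diff_le_self min.absorb2)
  then have "length u = length w"
    using le by linarith
  then show "u = w"
    using \<open>prefix u w\<close> by (auto simp: prefix_def)
qed

lemma enc_bits_attained:
  assumes "D w = Some x"
  obtains w' where "D w' = Some x" and "length w' = enc_bits D x"
proof -
  have "\<exists>n w'. D w' = Some x \<and> length w' = n"
    using assms by blast
  from LeastI_ex[OF this] show thesis
    using that unfolding enc_bits_def by blast
qed

section \<open>Algorithms that read one codeword\<close>

definition advised_algorithm ::
  "(bool list \<Rightarrow> 'a option) \<Rightarrow> ('a \<Rightarrow> 'v pair_pre_digraph \<Rightarrow> 'v list \<Rightarrow> nat) \<Rightarrow> 'v algorithm" where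
  "advised_algorithm D f G rs tr =
    (case D (map snd tr) of None \<Rightarrow> Read (length tr) | Some x \<Rightarrow> Color (f x G rs))"

definition advice_tape :: "bool list \<Rightarrow> tape" where
  "advice_tape w i \<longleftrightarrow> i < length w \<and> w ! i"

lemma map_advice_tape_upt: "m \<le> length w \<Longrightarrow> map (advice_tape w) [0..<m] = take m w"
  by (intro nth_equalityI) (auto simp: advice_tape_def)

lemma serve_advised_algorithm:
  assumes "prefix_free D" and "D w = Some x" and "m \<le> length w"
  shows "serve (advised_algorithm D f) G (advice_tape w) rs
    (map (\<lambda>i. (i, advice_tape w i)) [0..<m]) (f x G rs) {m..<length w}"
  using assms(3)
proof (induction rule: inc_induct)
  case base
  show ?case
    using assms(2)
    by (auto intro!: serve.color simp: advised_algorithm_def comp_def map_advice_tape_upt)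
next
  case (step m)
  have "advised_algorithm D f G rs (map (\<lambda>i. (i, advice_tape w i)) [0..<m]) = Read m"
    using prefix_free_take_eq_None[OF assms(1,2)] step.hyps
    by (simp add: advised_algorithm_def comp_def map_advice_tape_upt)
  moreover have "{m..<length w} = insert m {Suc m..<length w}"
    using step.hyps by auto
  ultimately show ?case
    using step.IH by (auto intro!: serve.read)
qed

lemma run_advised_algorithm_iff:
  assumes "prefix_free D" and "D w = Some x"
  shows "run (advised_algorithm D f) G (advice_tape w) I cs R \<longleftrightarrow>
    cs = online_coloring (f x G) I \<and> R = (\<Union>j < length I. {0..<length w})"
proof -
  have "run (advised_algorithm D f) G (advice_tape w) I
      (online_coloring (f x G) I) (\<Union>j < length I. {0..<length w})"
    using serve_advised_algorithm[OF assms, of 0] unfolding run_def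
    by (intro conjI exI[of _ "\<lambda>_. {0..<length w}"]) (auto simp: online_coloring_def)
  then show ?thesis
    using run_deterministic by metis
qed

lemma max_index_le:
  assumes "R \<subseteq> {0..<n}"
  shows "max_index R \<le> n"
proof -
  have "finite R"
    using assms finite_subset by blast
  then show ?thesis
    using assms unfolding max_index_def by (intro Max.boundedI) (auto simp: Suc_le_eq)
qed

section \<open>Leading bits\<close>

definition leading_bits :: "nat \<Rightarrow> nat \<Rightarrow> bool list" where
  "leading_bits b n = map (bit (drop_bit (floorlog 2 n - b) n)) [0..<b]"

definition max_completion :: "nat \<Rightarrow> bool list \<Rightarrow> nat" where
  "max_completion a bs = push_bit a (horner_sum of_bool 2 bs) + mask a"

lemma length_leading_bits [simp]: "length (leading_bits b n) = b"
  by (simp add: leading_bits_def)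

lemma horner_sum_leading_bits:
  "horner_sum of_bool 2 (leading_bits b n) = drop_bit (floorlog 2 n - b) n"
proof -
  let ?a = "floorlog 2 n - b"
  have "n < 2 ^ (?a + b)"
    by (rule floorlog_leD) simp_all
  then have "drop_bit ?a n < 2 ^ b"
    by (simp add: drop_bit_eq_div less_mult_imp_div_less power_add mult.commute)
  then show ?thesis
    by (simp add: leading_bits_def horner_sum_bit_eq_take_bit take_bit_nat_eq_self)
qed

definition round_up :: "nat \<Rightarrow> nat \<Rightarrow> nat" where
  "round_up b n = max_completion (floorlog 2 n - b) (leading_bits b n)"

lemma round_up_add_take_bit:
  "round_up b n + take_bit (floorlog 2 n - b) n = n + mask (floorlog 2 n - b)"
  using bits_ident[of "floorlog 2 n - b" n]
  by (simp add: round_up_def max_completion_def horner_sum_leading_bits)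

lemma le_round_up: "n \<le> round_up b n"
  using round_up_add_take_bit[of b n] take_bit_nat_less_eq_mask[of "floorlog 2 n - b" n]
  by linarith

lemma mask_floorlog_diff_le:
  assumes "b \<ge> 1"
  shows "mask (floorlog 2 n - b) * 2 ^ (b - 1) \<le> n"
proof (cases "floorlog 2 n - b = 0")
  case False
  then have "n > 0" and exponent: "floorlog 2 n - b + (b - 1) = floorlog 2 n - 1"
    using assms by (auto simp: floorlog_def split: if_splits)
  have "mask (floorlog 2 n - b) * 2 ^ (b - 1) \<le> (2 :: nat) ^ (floorlog 2 n - b) * 2 ^ (b - 1)"
    by (simp add: mask_eq_exp_minus_1)
  also have "\<dots> = 2 ^ (floorlog 2 n - 1)"
    by (simp only: exponent flip: power_add)
  also have "\<dots> \<le> n"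
    using floorlog_bounds[of n 2] \<open>n > 0\<close> by simp
  finally show ?thesis .
qed simp

lemma round_up_le:
  assumes "b \<ge> 1"
  shows "real (round_up b n) \<le> (1 + 1 / 2 ^ (b - 1)) * real n"
proof -
  let ?a = "floorlog 2 n - b"
  have "real (round_up b n) \<le> real (n + mask ?a)"
    unfolding of_nat_le_iff using round_up_add_take_bit[of b n] by linarith
  moreover have "real (mask ?a) \<le> real n / 2 ^ (b - 1)"
    using of_nat_mono[OF mask_floorlog_diff_le[OF assms, of n], where ?'a = real]
    by (simp add: pos_le_divide_eq)
  ultimately show ?thesis
    by (simp add: algebra_simps)
qed

section \<open>The two-sided algorithm\<close>

definition two_sided_algorithm :: "(bool list \<Rightarrow> nat option) \<Rightarrow> nat \<Rightarrow> 'v algorithm" where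
  "two_sided_algorithm D b = advised_algorithm (with_suffix b D)
    (\<lambda>(a, bs) G. two_sided_color (left_side G) (max_completion a bs))"

lemma run_two_sided_algorithm_iff:
  assumes "prefix_free D" and "D w = Some (floorlog 2 n - b)"
  shows "run (two_sided_algorithm D b) G (advice_tape (w @ leading_bits b n)) I cs R \<longleftrightarrow>
    cs = online_coloring (two_sided_color (left_side G) (round_up b n)) I \<and>
    R = (\<Union>j < length I. {0..<length w + b})"
proof -
  have "with_suffix b D (w @ leading_bits b n) = Some (floorlog 2 n - b, leading_bits b n)"
    using with_suffix_append[of D w _ "leading_bits b n"] assms(2) by simp
  note run_iff = run_advised_algorithm_iff[OF prefix_free_with_suffix[OF assms(1)] this]
  show ?thesis
    by (simp add: two_sided_algorithm_def round_up_def run_iff)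
qed

lemma card_two_sided_coloring_round_up_le:
  assumes "b \<ge> 1"
  shows "real (card (set (online_coloring (two_sided_color X (round_up b (Opt G I))) I)))
    \<le> (1 + 1 / 2 ^ (b - 1)) * real (Opt G I)"
proof -
  have "count_list I v \<le> round_up b (Opt G I)" for v
    using count_list_le_Opt le_round_up by (rule order_trans)
  then have "card (set (online_coloring (two_sided_color X (round_up b (Opt G I))) I))
      \<le> round_up b (Opt G I)"
    by (rule card_two_sided_coloring_le)
  then show ?thesis
    using round_up_le[OF assms, of "Opt G I"] by linarith
qed

theorem theorem5:
  fixes b :: nat and D :: "bool list \<Rightarrow> nat option"
  assumes "b \<ge> 1" and "self_delimiting D"
  shows "\<exists>(A :: 'v algorithm) (\<O> :: 'v advisor).
    online_algorithm bipartite_graphs A \<O> \<and>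
    strictly_competitive bipartite_graphs (1 + 1 / 2 ^ (b - 1)) A \<O> \<and>
    advice_complexity_le bipartite_graphs
      (\<lambda>opt. let a = floorlog 2 opt - b in b + enc_bits D a) A \<O>"
proof -
  have "prefix_free D" and "\<exists>w. D w = Some x \<and> length w = enc_bits D x" for x
    using assms(2) enc_bits_attained unfolding self_delimiting_def prefix_free_def by metis+
  then obtain code where code: "\<And>x. D (code x) = Some x" "\<And>x. length (code x) = enc_bits D x"
    by metis
  let ?a = "\<lambda>n. floorlog 2 n - b"
  define A :: "'v algorithm" where "A = two_sided_algorithm D b"
  define \<O> :: "'v advisor" where
    "\<O> G I = advice_tape (code (?a (Opt G I)) @ leading_bits b (Opt G I))" for G I
  have run_iff: "run A G (\<O> G I) I cs R \<longleftrightarrow>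
      cs = online_coloring (two_sided_color (left_side G) (round_up b (Opt G I))) I \<and>
      R = (\<Union>j < length I. {0..<enc_bits D (?a (Opt G I)) + b})" for G I cs R
    unfolding A_def \<O>_def
    by (simp only: run_two_sided_algorithm_iff[OF \<open>prefix_free D\<close> code(1)] code(2))
  have "online_algorithm bipartite_graphs A \<O>"
    by (simp add: online_algorithm_def run_iff multicoloring_left_side le_round_up)
  moreover have "strictly_competitive bipartite_graphs (1 + 1 / 2 ^ (b - 1)) A \<O>"
    using assms(1) unfolding strictly_competitive_def run_iff
    by (blast intro: card_two_sided_coloring_round_up_le)
  moreover have "advice_complexity_le bipartite_graphs
      (\<lambda>opt. let a = floorlog 2 opt - b in b + enc_bits D a) A \<O>"
    by (auto simp: advice_complexity_le_def run_iff Let_def intro!: max_index_le)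
  ultimately show ?thesis by blast
qed

end
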